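(* For every integer $n\ge1$, every $c\in\mathbb{Q}$ and every $w\in\mathfrak{H}$, \[ \partial_n^{(c)}(wx)=\bigl(w\diamond q_n^{(c)}\bigr)x. \]
   Context: Let $\mathfrak{H}=\mathbb{Q}\langle x,y\rangle$ be the noncommutative polynomial algebra in $x,y$, and set $z=x+y$. For $n\ge1$, $\partial_n$ is the $\mathbb{Q}$-linear derivation of $\mathfrak{H}$ with $\partial_n(x)=yz^{n-1}x$ and $\partial_n(y)=-yz^{n-1}x$. Let $H:\mathfrak{H}\to\mathfrak{H}$ be the $\mathbb{Q}$-linear map with $H(w)=\deg(w)\,w$ for every monomial $w$. For $c\in\mathbb{Q}$, $\theta=\theta^{(c)}$ is the unique $\mathbb{Q}$-linear map $\mathfrak{H}\to\mathfrak{H}$ with $\theta(1)=0$, $\theta(x)=xz$, $\theta(y)=yz$ and $\theta(ww')=\theta(w)w'+w\theta(w')+cH(w)\partial_1(w')$ for all $w,w'\in\mathfrak{H}$. Define $\partial_n^{(c)}=\frac{1}{(n-1)!}\mathrm{ad}(\theta)^{n-1}(\partial_1)$, where $\mathrm{ad}(\theta)(D)=\theta\circ D-D\circ\theta$. Let $\tilde\theta=\tilde\theta^{(c)}:\mathfrak{H}\to\mathfrak{H}$ be $\tilde\theta(w)=\theta(w)+cH(w)y$, and $q_n=q_n^{(c)}=\frac{1}{(n-1)!}\tilde\theta^{\,n-1}(y)$. The harmonic product $*$ on $\mathfrak{H}$ is the $\mathbb{Q}$-bilinear product defined recursively by $1*w=w*1=w$, $xw_1*w_2=w_1*xw_2=x(w_1*w_2)$,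 and $yw_1*yw_2=y(w_1*yw_2)+y(yw_1*w_2)+yx(w_1*w_2)$ for $w,w_1,w_2\in\mathfrak{H}$. Let $\phi$ be the algebra automorphism of $\mathfrak{H}$ with $\phi(x)=z$, $\phi(y)=-y$ (an involution). Define $w_1\diamond w_2=\phi(\phi(w_1)*\phi(w_2))$. *)

theory Defs
  imports Complex_Main "HOL-Library.Poly_Mapping"
begin

section \<open>The algebra of noncommutative polynomials in two letters\<close>

text \<open>
  Words form the free monoid, written additively (addition is concatenation) because the
  library's convolution product on finitely supported functions is indexed by a
  \<^class>\<open>monoid_add\<close>. With this instance, \<open>letter list \<Rightarrow>\<^sub>0 rat\<close> is the monoid algebra of the
  free monoid on two letters, i.e. the algebra of noncommutative polynomials.
\<close>

instantiation list :: (type) monoid_add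
begin
definition zero_list :: "'a list" where "zero_list = []"
definition plus_list :: "'a list \<Rightarrow> 'a list \<Rightarrow> 'a list" where "plus_list u v = u @ v"
instance by standard (simp_all add: zero_list_def plus_list_def)
end

datatype letter = Lx | Ly

type_synonym ncpoly = "letter list \<Rightarrow>\<^sub>0 rat"

definition mon :: "letter list \<Rightarrow> ncpoly"
  where "mon u = Poly_Mapping.single u 1"

definition X :: ncpoly where "X = mon [Lx]"
definition Y :: ncpoly where "Y = mon [Ly]"
definition Z :: ncpoly where "Z = X + Y"

definition smul :: "rat \<Rightarrow> ncpoly \<Rightarrow> ncpoly" (infixr \<open>*\<^sub>Q\<close> 75)
  where "a *\<^sub>Q p = Poly_Mapping.map ((*) a) p"

abbreviation qlinear :: "(ncpoly \<Rightarrow> ncpoly) \<Rightarrow> bool"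
  where "qlinear \<equiv> Vector_Spaces.linear smul smul"

definition lin_ext :: "(letter list \<Rightarrow> ncpoly) \<Rightarrow> ncpoly \<Rightarrow> ncpoly"
  where "lin_ext f p = (\<Sum>u \<in> Poly_Mapping.keys p. Poly_Mapping.lookup p u *\<^sub>Q f u)"


section \<open>The operators\<close>

definition derivation :: "(ncpoly \<Rightarrow> ncpoly) \<Rightarrow> bool"
  where "derivation D \<longleftrightarrow> qlinear D \<and> (\<forall>u v. D (u * v) = D u * v + u * D v)"

text \<open>
  Existence and uniqueness of the maps introduced by definite descriptions below are
  proved in the lemmas \<open>partial_ex1\<close>, \<open>theta_ex1\<close> and \<open>phi_ex1\<close>.
\<close>

definition is_partial :: "nat \<Rightarrow> (ncpoly \<Rightarrow> ncpoly) \<Rightarrow> bool"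
  where "is_partial n D \<longleftrightarrow>
    derivation D \<and> D X = Y * Z ^ (n - 1) * X \<and> D Y = - (Y * Z ^ (n - 1) * X)"

definition partial :: "nat \<Rightarrow> ncpoly \<Rightarrow> ncpoly"
  where "partial n = (THE D. is_partial n D)"

definition degop :: "ncpoly \<Rightarrow> ncpoly"
  where "degop = lin_ext (\<lambda>u. of_nat (length u) *\<^sub>Q mon u)"

definition is_theta :: "rat \<Rightarrow> (ncpoly \<Rightarrow> ncpoly) \<Rightarrow> bool"
  where "is_theta c T \<longleftrightarrow> qlinear T \<and> T 1 = 0 \<and> T X = X * Z \<and> T Y = Y * Z \<and>
    (\<forall>u v. T (u * v) = T u * v + u * T v + c *\<^sub>Q (degop u * partial 1 v))"

definition theta :: "rat \<Rightarrow> ncpoly \<Rightarrow> ncpoly"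
  where "theta c = (THE T. is_theta c T)"

definition ad :: "(ncpoly \<Rightarrow> ncpoly) \<Rightarrow> (ncpoly \<Rightarrow> ncpoly) \<Rightarrow> ncpoly \<Rightarrow> ncpoly"
  where "ad T D = (\<lambda>w. T (D w) - D (T w))"

definition partial_c :: "nat \<Rightarrow> rat \<Rightarrow> ncpoly \<Rightarrow> ncpoly"
  where "partial_c n c w = (1 / fact (n - 1)) *\<^sub>Q (ad (theta c) ^^ (n - 1)) (partial 1) w"

definition theta_tilde :: "rat \<Rightarrow> ncpoly \<Rightarrow> ncpoly"
  where "theta_tilde c w = theta c w + c *\<^sub>Q (degop w * Y)"

definition q_poly :: "nat \<Rightarrow> rat \<Rightarrow> ncpoly"
  where "q_poly n c = (1 / fact (n - 1)) *\<^sub>Q (theta_tilde c ^^ (n - 1)) Y"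


section \<open>The harmonic product and its conjugate\<close>

text \<open>
  The harmonic product is defined on words and extended bilinearly; the defining identities for
  arbitrary polynomials are the lemmas \<open>harm_one_left\<close>, \<open>harm_one_right\<close>, \<open>harm_X_left\<close>,
  \<open>harm_X_right\<close> and \<open>harm_Y_Y\<close>.
\<close>

fun harm_word :: "letter list \<Rightarrow> letter list \<Rightarrow> ncpoly" where
  "harm_word [] v = mon v"
| "harm_word u [] = mon u"
| "harm_word (Lx # u) v = X * harm_word u v"
| "harm_word u (Lx # v) = X * harm_word u v"
| "harm_word (Ly # u) (Ly # v) =
     Y * harm_word u (Ly # v) + Y * harm_word (Ly # u) v + Y * X * harm_word u v"

definition harm :: "ncpoly \<Rightarrow> ncpoly \<Rightarrow> ncpoly" (infixl \<open>\<star>\<close> 70)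
  where "p \<star> r = lin_ext (\<lambda>u. lin_ext (\<lambda>v. harm_word u v) r) p"

definition alg_hom :: "(ncpoly \<Rightarrow> ncpoly) \<Rightarrow> bool"
  where "alg_hom f \<longleftrightarrow> qlinear f \<and> f 1 = 1 \<and> (\<forall>u v. f (u * v) = f u * f v)"

definition is_phi :: "(ncpoly \<Rightarrow> ncpoly) \<Rightarrow> bool"
  where "is_phi f \<longleftrightarrow> alg_hom f \<and> bij f \<and> f X = Z \<and> f Y = - Y"

definition phi :: "ncpoly \<Rightarrow> ncpoly"
  where "phi = (THE f. is_phi f)"

definition diamond :: "ncpoly \<Rightarrow> ncpoly \<Rightarrow> ncpoly" (infixl \<open>\<diamondop>\<close> 70)
  where "u \<diamondop> v = phi (phi u \<star> phi v)"


section \<open>Well-definedness\<close>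

lemma smul_single: "a *\<^sub>Q p = Poly_Mapping.single 0 a * p"
  by (simp add: smul_def mult_map_scale_conv_mult)

lemma lookup_smul [simp]: "Poly_Mapping.lookup (a *\<^sub>Q p) u = a * Poly_Mapping.lookup p u"
  by (simp add: smul_def Poly_Mapping.map.rep_eq when_def)

lemma smul_mon: "a *\<^sub>Q mon u = Poly_Mapping.single u a"
  by (simp add: mon_def smul_single mult_single)

lemma smul_add: "a *\<^sub>Q (p + r) = a *\<^sub>Q p + a *\<^sub>Q r"
  and smul_add_left: "(a + b) *\<^sub>Q p = a *\<^sub>Q p + b *\<^sub>Q p"
  and smul_smul: "a *\<^sub>Q b *\<^sub>Q p = (a * b) *\<^sub>Q p"
  and smul_one [simp]: "1 *\<^sub>Q p = p"
  and smul_zero [simp]: "a *\<^sub>Q 0 = 0" "0 *\<^sub>Q p = 0"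
  and smul_minus: "a *\<^sub>Q (- p) = - (a *\<^sub>Q p)"
  by (rule poly_mapping_eqI; simp add: lookup_add algebra_simps)+

lemma vector_space_smul: "vector_space smul"
  by unfold_locales (simp_all add: smul_add smul_add_left smul_smul)

lemma qlinear_iff:
  "qlinear f \<longleftrightarrow> (\<forall>p r. f (p + r) = f p + f r) \<and> (\<forall>a p. f (a *\<^sub>Q p) = a *\<^sub>Q f p)"
  by (simp add: Vector_Spaces.linear_iff vector_space_smul)

lemma qlinear_add: "qlinear f \<Longrightarrow> f (p + r) = f p + f r"
  and qlinear_smul: "qlinear f \<Longrightarrow> f (a *\<^sub>Q p) = a *\<^sub>Q f p"
  by (simp_all add: qlinear_iff)

lemma qlinear_zero: "qlinear f \<Longrightarrow> f 0 = 0"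
  by (metis qlinear_smul smul_zero(2))

lemma qlinear_minus: "qlinear f \<Longrightarrow> f (- p) = - f p"
  by (metis add.right_inverse minus_unique qlinear_add qlinear_zero)

lemma mon_Nil: "mon [] = 1"
  unfolding mon_def by (metis single_one zero_list_def)

lemma mon_mult: "mon u * mon v = mon (u @ v)"
  by (simp add: mon_def mult_single plus_list_def)

lemma mon_Cons: "mon (a # u) = mon [a] * mon u"
  by (simp add: mon_mult)

lemma smul_mult_left: "(a *\<^sub>Q p) * r = a *\<^sub>Q (p * r)"
  by (simp add: smul_single mult.assoc)

lemma ncpoly_induct [case_names zero add]:
  assumes "P 0" and "\<And>p a u. P p \<Longrightarrow> P (p + a *\<^sub>Q mon u)"
  shows "P p"
proof (induction p rule: update_induct)
  case const
  then show ?case by (rule assms)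
next
  case (update f a b)
  have "Poly_Mapping.update a b f = f + b *\<^sub>Q mon a"
    using update(1) by (intro poly_mapping_eqI)
      (auto simp: lookup_update lookup_add smul_mon lookup_single when_def in_keys_iff)
  then show ?case using assms(2)[OF update.IH] by simp
qed

lemma single_central: "p * Poly_Mapping.single 0 a = Poly_Mapping.single 0 a * p" for p :: ncpoly
proof (induction p rule: ncpoly_induct)
  case (add p b u)
  then show ?case by (simp add: smul_mon algebra_simps mult_single)
qed simp

lemma smul_mult_right: "p * (a *\<^sub>Q r) = a *\<^sub>Q (p * r)"
  by (metis smul_single mult.assoc single_central)

lemmas smul_alg = smul_add smul_add_left smul_smul smul_minus smul_mult_left smul_mult_right

lemma qlinear_eqI:
  assumes "qlinear f" "qlinear g" "\<And>u. f (mon u) = g (mon u)"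
  shows "f = g"
proof
  fix p show "f p = g p"
    by (induction p rule: ncpoly_induct)
      (simp_all add: assms qlinear_add qlinear_smul qlinear_zero)
qed

lemma qlinear_eqI2:
  assumes "\<And>v. qlinear (\<lambda>u. B u v)" "\<And>u. qlinear (B u)"
    and "\<And>v. qlinear (\<lambda>u. C u v)" "\<And>u. qlinear (C u)"
    and "\<And>u v. B (mon u) (mon v) = C (mon u) (mon v)"
  shows "B p r = C p r"
proof -
  have "B (mon u) = C (mon u)" for u
    by (rule qlinear_eqI) (simp_all add: assms)
  then have "(\<lambda>p. B p r) = (\<lambda>p. C p r)"
    by (intro qlinear_eqI) (simp_all add: assms)
  then show ?thesis by (rule fun_cong)
qed

lemma lin_ext_superset:
  assumes "finite A" "Poly_Mapping.keys p \<subseteq> A"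
  shows "lin_ext f p = (\<Sum>u \<in> A. Poly_Mapping.lookup p u *\<^sub>Q f u)"
  unfolding lin_ext_def using assms
  by (intro sum.mono_neutral_left) (auto simp: in_keys_iff)

lemma qlinear_lin_ext: "qlinear (lin_ext f)"
  unfolding qlinear_iff
proof (intro conjI allI)
  fix p r :: ncpoly and a :: rat
  let ?A = "Poly_Mapping.keys p \<union> Poly_Mapping.keys r"
  have "lin_ext f (p + r) = (\<Sum>u \<in> ?A. Poly_Mapping.lookup (p + r) u *\<^sub>Q f u)"
    by (intro lin_ext_superset) (simp_all add: keys_add)
  also have "\<dots> = lin_ext f p + lin_ext f r"
    by (simp add: lin_ext_superset[of ?A] lookup_add smul_add_left sum.distrib)
  finally show "lin_ext f (p + r) = lin_ext f p + lin_ext f r" .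
  have "lin_ext f (a *\<^sub>Q p) = (\<Sum>u \<in> Poly_Mapping.keys p. Poly_Mapping.lookup (a *\<^sub>Q p) u *\<^sub>Q f u)"
    by (intro lin_ext_superset) (auto simp: in_keys_iff)
  also have "\<dots> = (\<Sum>u \<in> Poly_Mapping.keys p. a *\<^sub>Q (Poly_Mapping.lookup p u *\<^sub>Q f u))"
    by (simp add: smul_smul)
  also have "\<dots> = a *\<^sub>Q lin_ext f p"
    unfolding lin_ext_def by (induction rule: infinite_finite_induct) (simp_all add: smul_add)
  finally show "lin_ext f (a *\<^sub>Q p) = a *\<^sub>Q lin_ext f p" .
qed

lemma lin_ext_mon [simp]: "lin_ext f (mon u) = f u"
  by (simp add: lin_ext_def mon_def)

lemmas lin_ext_add = qlinear_add[OF qlinear_lin_ext]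
  and lin_ext_smul = qlinear_smul[OF qlinear_lin_ext]

lemma degop_mon: "degop (mon u) = of_nat (length u) *\<^sub>Q mon u"
  and qlinear_degop: "qlinear degop"
  by (simp_all add: degop_def qlinear_lin_ext)

primrec partial_word :: "nat \<Rightarrow> letter list \<Rightarrow> ncpoly" where
  "partial_word n [] = 0"
| "partial_word n (a # u) =
     (case a of Lx \<Rightarrow> Y * Z ^ (n - 1) * X | Ly \<Rightarrow> - (Y * Z ^ (n - 1) * X)) * mon u
     + mon [a] * partial_word n u"

lemma partial_word_append: "partial_word n (u @ v) = partial_word n u * mon v + mon u * partial_word n v"
proof (induction u)
  case Nil
  then show ?case by (simp add: mon_Nil)
next
  case (Cons a u)
  then show ?case
    by (simp add: mon_mult[symmetric] mon_Cons[of a u] algebra_simps)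
qed

lemma derivation_one: "derivation D \<Longrightarrow> D 1 = 0"
  unfolding derivation_def by (metis add_cancel_right_right mult.left_neutral mult.right_neutral)

lemma is_partial_mon:
  assumes "is_partial n D"
  shows "D (mon u) = partial_word n u"
proof (induction u)
  case Nil
  then show ?case using assms by (simp add: mon_Nil is_partial_def derivation_one)
next
  case (Cons a u)
  have "D (mon (a # u)) = D (mon [a]) * mon u + mon [a] * D (mon u)"
    using assms by (simp add: mon_Cons[of a u] is_partial_def derivation_def del: mon_mult)
  then show ?case
    using assms Cons by (cases a) (simp_all add: is_partial_def X_def Y_def)
qed

lemma is_partial_ext: "is_partial n (lin_ext (partial_word n))"
proof -
  let ?D = "lin_ext (partial_word n)"
  have "?D (u * v) = ?D u * v + u * ?D v" for u v
    by (rule qlinear_eqI2[where B = "\<lambda>u v. ?D (u * v)" and C = "\<lambda>u v. ?D u * v + u * ?D v"])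
      (simp_all add: qlinear_iff algebra_simps lin_ext_add lin_ext_smul smul_alg
        mon_mult partial_word_append)
  then show ?thesis
    by (simp add: is_partial_def derivation_def qlinear_lin_ext)
      (simp add: X_def Y_def mon_Nil)
qed

lemma partial_ex1: "\<exists>!D. is_partial n D"
proof (rule ex1I)
  show "is_partial n (lin_ext (partial_word n))" by (rule is_partial_ext)
next
  fix D assume D: "is_partial n D"
  then have "qlinear D" by (simp add: is_partial_def derivation_def)
  then show "D = lin_ext (partial_word n)"
    by (rule qlinear_eqI) (simp_all add: qlinear_lin_ext is_partial_mon[OF D])
qed

lemma is_partial_partial: "is_partial n (partial n)"
  unfolding partial_def by (rule theI'[OF partial_ex1])

primrec theta_word :: "rat \<Rightarrow> letter list \<Rightarrow> ncpoly" where
  "theta_word c [] = 0"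
| "theta_word c (a # u) =
     mon [a] * Z * mon u + mon [a] * theta_word c u + c *\<^sub>Q (mon [a] * partial 1 (mon u))"

lemma partial_mult: "partial n (u * v) = partial n u * v + u * partial n v"
  and qlinear_partial: "qlinear (partial n)"
  and partial_one: "partial n 1 = 0"
  using is_partial_partial[of n] derivation_one by (auto simp: is_partial_def derivation_def)

lemma theta_word_append:
  "theta_word c (u @ v) = theta_word c u * mon v + mon u * theta_word c v
     + c *\<^sub>Q (degop (mon u) * partial 1 (mon v))"
proof (induction u)
  case Nil
  then show ?case by (simp add: mon_Nil degop_mon[of "[]", simplified mon_Nil])
next
  case (Cons a u)
  show ?case
    unfolding append_Cons theta_word.simps Cons
    by (simp add: mon_mult[symmetric] mon_Cons[of a u] degop_mon partial_mult algebra_simps smul_alg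
        degop_mon[of "a # u", unfolded mon_Cons[of a u]])
qed

lemma is_theta_mon:
  assumes "is_theta c T"
  shows "T (mon u) = theta_word c u"
proof (induction u)
  case Nil
  then show ?case using assms by (simp add: mon_Nil is_theta_def)
next
  case (Cons a u)
  have "T (mon (a # u)) = T (mon [a]) * mon u + mon [a] * T (mon u)
      + c *\<^sub>Q (degop (mon [a]) * partial 1 (mon u))"
    using assms by (simp add: mon_Cons[of a u] is_theta_def)
  then show ?case
    using assms Cons by (cases a) (simp_all add: is_theta_def X_def Y_def degop_mon)
qed

lemma is_theta_ext: "is_theta c (lin_ext (theta_word c))"
proof -
  let ?T = "lin_ext (theta_word c)"
  have "?T (u * v) = ?T u * v + u * ?T v + c *\<^sub>Q (degop u * partial 1 v)" for u v
    by (rule qlinear_eqI2[where B = "\<lambda>u v. ?T (u * v)"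
          and C = "\<lambda>u v. ?T u * v + u * ?T v + c *\<^sub>Q (degop u * partial 1 v)"])
      (simp_all add: qlinear_iff algebra_simps lin_ext_add lin_ext_smul smul_alg
        qlinear_add[OF qlinear_degop] qlinear_smul[OF qlinear_degop]
        qlinear_add[OF qlinear_partial] qlinear_smul[OF qlinear_partial]
        mon_mult theta_word_append)
  moreover have "?T 1 = 0" unfolding mon_Nil[symmetric] by simp
  ultimately show ?thesis
    by (simp add: is_theta_def qlinear_lin_ext) (simp add: X_def Y_def mon_Nil partial_one)
qed

lemma theta_ex1: "\<exists>!T. is_theta c T"
proof (rule ex1I)
  show "is_theta c (lin_ext (theta_word c))" by (rule is_theta_ext)
next
  fix T assume T: "is_theta c T"
  then have "qlinear T" by (simp add: is_theta_def)
  then show "T = lin_ext (theta_word c)"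
    by (rule qlinear_eqI) (simp_all add: qlinear_lin_ext is_theta_mon[OF T])
qed

lemma is_theta_theta: "is_theta c (theta c)"
  unfolding theta_def by (rule theI'[OF theta_ex1])

primrec phi_word :: "letter list \<Rightarrow> ncpoly" where
  "phi_word [] = 1"
| "phi_word (a # u) = (case a of Lx \<Rightarrow> Z | Ly \<Rightarrow> - Y) * phi_word u"

lemma phi_word_append: "phi_word (u @ v) = phi_word u * phi_word v"
  by (induction u) (simp_all add: mult.assoc)

lemma alg_hom_phi: "alg_hom (lin_ext phi_word)"
proof -
  let ?f = "lin_ext phi_word"
  have "?f (u * v) = ?f u * ?f v" for u v
    by (rule qlinear_eqI2[where B = "\<lambda>u v. ?f (u * v)" and C = "\<lambda>u v. ?f u * ?f v"])
      (simp_all add: qlinear_iff algebra_simps lin_ext_add lin_ext_smul smul_alg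
        mon_mult phi_word_append)
  moreover have "?f 1 = 1" using lin_ext_mon[of phi_word "[]"] by (simp add: mon_Nil)
  ultimately show ?thesis by (simp add: alg_hom_def qlinear_lin_ext)
qed

lemma alg_hom_eqI:
  assumes "alg_hom f" "alg_hom g" "f X = g X" "f Y = g Y"
  shows "f = g"
proof (rule qlinear_eqI)
  show "qlinear f" "qlinear g" using assms by (simp_all add: alg_hom_def)
  have a: "f (mon [a]) = g (mon [a])" for a
    using assms by (cases a) (simp_all add: X_def Y_def)
  show "f (mon u) = g (mon u)" for u
  proof (induction u)
    case Nil
    then show ?case using assms by (simp add: mon_Nil alg_hom_def)
  next
    case (Cons b u)
    then show ?case using assms a by (simp add: mon_Cons[of b u] alg_hom_def)
  qed
qed

lemma phi_ext_X_Y: "lin_ext phi_word X = Z" "lin_ext phi_word Y = - Y"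
  by (simp_all add: X_def Y_def)

lemma phi_ext_invol: "lin_ext phi_word (lin_ext phi_word p) = p"
proof -
  let ?f = "lin_ext phi_word"
  have "(\<lambda>p. ?f (?f p)) = (\<lambda>p. p)"
  proof (rule alg_hom_eqI)
    show "alg_hom (\<lambda>p. ?f (?f p))"
      using alg_hom_phi by (simp add: alg_hom_def qlinear_iff)
    show "alg_hom (\<lambda>p. p)" by (simp add: alg_hom_def qlinear_iff)
    show "?f (?f X) = X" "?f (?f Y) = Y"
      by (simp_all add: phi_ext_X_Y qlinear_minus[OF qlinear_lin_ext])
        (simp add: Z_def lin_ext_add phi_ext_X_Y)
  qed
  then show ?thesis by (rule fun_cong)
qed

lemma is_phi_ext: "is_phi (lin_ext phi_word)"
  unfolding is_phi_def
  using alg_hom_phi phi_ext_X_Y phi_ext_invol by (auto intro: involuntory_imp_bij)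

lemma phi_ex1: "\<exists>!f. is_phi f"
proof (rule ex1I)
  show "is_phi (lin_ext phi_word)" by (rule is_phi_ext)
next
  fix f assume "is_phi f"
  then show "f = lin_ext phi_word"
    by (intro alg_hom_eqI) (simp_all add: is_phi_def alg_hom_phi phi_ext_X_Y)
qed

lemma is_phi_phi: "is_phi phi"
  unfolding phi_def by (rule theI'[OF phi_ex1])

lemma phi_phi: "phi (phi p) = p"
  using phi_ext_invol is_phi_phi is_phi_ext phi_ex1 by metis


section \<open>Characterisation of the harmonic product\<close>

lemma harm_mon: "mon u \<star> mon v = harm_word u v"
  by (simp add: harm_def)

lemma qlinear_harm_left: "qlinear (\<lambda>p. p \<star> r)"
  unfolding harm_def by (rule qlinear_lin_ext)

lemma qlinear_harm_right: "qlinear (harm p)"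
proof -
  have "p \<star> (r + s) = p \<star> r + p \<star> s" "p \<star> (a *\<^sub>Q r) = a *\<^sub>Q (p \<star> r)" for r s a
    by (induction p rule: ncpoly_induct)
      (simp_all add: qlinear_add[OF qlinear_harm_left] qlinear_smul[OF qlinear_harm_left]
        qlinear_zero[OF qlinear_harm_left], simp_all add: harm_def lin_ext_add lin_ext_smul
        smul_alg algebra_simps)
  then show ?thesis by (simp add: qlinear_iff)
qed

lemma harm_word_Nil: "harm_word u [] = mon u"
  by (cases u) auto

lemma harm_word_Lx_left: "harm_word (Lx # u) v = X * harm_word u v"
  by (cases v) (simp_all add: harm_word_Nil X_def mon_mult)

lemma harm_word_Lx_right: "harm_word u (Lx # v) = X * harm_word u v"
proof (induction u)
  case Nil
  then show ?case by (simp add: X_def mon_mult)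
next
  case (Cons a u)
  then show ?case by (cases a) (simp_all add: harm_word_Lx_left)
qed

lemmas harm_lin = qlinear_add[OF qlinear_harm_left] qlinear_smul[OF qlinear_harm_left]
  qlinear_add[OF qlinear_harm_right] qlinear_smul[OF qlinear_harm_right]

lemma harm_one_left: "1 \<star> w = w"
proof -
  have "harm 1 = (\<lambda>w. w)"
    by (rule qlinear_eqI)
      (simp add: qlinear_harm_right, simp add: qlinear_iff, simp add: mon_Nil[symmetric] harm_mon)
  then show ?thesis by (rule fun_cong)
qed

lemma harm_one_right: "w \<star> 1 = w"
proof -
  have "(\<lambda>w. w \<star> 1) = (\<lambda>w. w)"
    by (rule qlinear_eqI)
      (simp add: qlinear_harm_left, simp add: qlinear_iff,
       simp add: mon_Nil[symmetric] harm_mon harm_word_Nil)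
  then show ?thesis by (rule fun_cong)
qed

lemma harm_X_left: "(X * u) \<star> v = X * (u \<star> v)"
  by (rule qlinear_eqI2[where B = "\<lambda>u v. (X * u) \<star> v" and C = "\<lambda>u v. X * (u \<star> v)"])
    (simp_all add: qlinear_iff harm_lin smul_alg distrib_left,
     simp add: X_def mon_mult harm_mon harm_word_Lx_left)

lemma harm_X_right: "u \<star> (X * v) = X * (u \<star> v)"
  by (rule qlinear_eqI2[where B = "\<lambda>u v. u \<star> (X * v)" and C = "\<lambda>u v. X * (u \<star> v)"])
    (simp_all add: qlinear_iff harm_lin smul_alg distrib_left,
     simp add: X_def mon_mult harm_mon harm_word_Lx_right)

lemma harm_Y_Y:
  "(Y * u) \<star> (Y * v) = Y * (u \<star> (Y * v)) + Y * ((Y * u) \<star> v) + Y * X * (u \<star> v)"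
  by (rule qlinear_eqI2[where B = "\<lambda>u v. (Y * u) \<star> (Y * v)"
        and C = "\<lambda>u v. Y * (u \<star> (Y * v)) + Y * ((Y * u) \<star> v) + Y * X * (u \<star> v)"])
    (simp_all add: qlinear_iff harm_lin smul_alg distrib_left add_ac,
     simp add: Y_def mon_mult harm_mon)

end

theory Submission
  imports Defs
begin

text \<open>
  The product \<open>\<diamondop>\<close> is commutative, and \<open>w \<diamondop> Y = partial 1 w + w * Y\<close> commutes with it in the
  sense that \<open>(w \<diamondop> Y) \<diamondop> v = (w \<diamondop> v) \<diamondop> Y\<close>. Consequently, for a letter \<open>a\<close> in \<open>{Y, Z}\<close>,
  \<open>theta_tilde c (a * w) = a * (Z * w + theta_tilde c w + c *\<^sub>Q (w \<diamondop> Y))\<close>, and by induction on words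
  in \<open>Y\<close> and \<open>Z\<close> the map \<open>theta_tilde c\<close> is a derivation with respect to \<open>\<diamondop>\<close>. Since every operator
  \<open>D\<close> obtained from \<open>partial 1\<close> by iterating \<open>ad (theta c)\<close> satisfies \<open>D (w * Z) = D w * Z\<close>,
  comparing \<open>theta c (D (w * X))\<close> with \<open>D (theta c (w * X))\<close> turns this derivation property into
  the induction step of the theorem.
\<close>

lemma qlinear_diff: "qlinear f \<Longrightarrow> f (p - r) = f p - f r"
  by (metis diff_conv_add_uminus qlinear_add qlinear_minus)

lemma smul_diff: "a *\<^sub>Q (p - r) = a *\<^sub>Q p - a *\<^sub>Q r"
  by (metis diff_conv_add_uminus smul_add smul_minus)

text \<open>As \<open>X = Z - Y\<close>, words in \<open>Y\<close> and \<open>Z\<close> span too. In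
  these letters \<open>\<diamondop>\<close> has simple recursions: \<open>Z\<close> leaves either
  factor, and \<open>Y\<close> obeys \<open>diamond_Y_Y\<close>.\<close>

lemma ncpoly_YZ_induct [case_names zero add smul one Y Z]:
  assumes zero: "P 0"
    and add: "\<And>p r. P p \<Longrightarrow> P r \<Longrightarrow> P (p + r)"
    and smul: "\<And>a p. P p \<Longrightarrow> P (a *\<^sub>Q p)"
    and one: "P 1"
    and Y: "\<And>p. P p \<Longrightarrow> P (Y * p)"
    and Z: "\<And>p. P p \<Longrightarrow> P (Z * p)"
  shows "P p"
proof -
  have "P (mon u)" for u
  proof (induction u)
    case Nil
    then show ?case by (simp add: mon_Nil one)
  next
    case (Cons a u)
    show ?case
    proof (cases a)
      case Lx
      have "mon (Lx # u) = Z * mon u + (- 1) *\<^sub>Q (Y * mon u)"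
        by (rule poly_mapping_eqI)
          (simp add: mon_Cons[of Lx u] X_def[symmetric] Z_def distrib_right lookup_add)
      then show ?thesis using Lx Cons by (simp add: add smul Y Z)
    next
      case Ly
      then show ?thesis using Y[OF Cons] by (simp add: Y_def mon_mult)
    qed
  qed
  then show ?thesis
    by (induction p rule: ncpoly_induct) (simp_all add: zero add smul)
qed

section \<open>Recursions and commutation laws for \<open>\<diamondop>\<close>\<close>

lemma qlinear_phi: "qlinear phi"
  and phi_one: "phi 1 = 1"
  and phi_mult: "phi (u * v) = phi u * phi v"
  and phi_X: "phi X = Z"
  and phi_Y: "phi Y = - Y"
  using is_phi_phi by (auto simp: is_phi_def alg_hom_def)

lemma phi_Z: "phi Z = X"
  using phi_phi[of X] by (simp add: phi_X)

lemma qlinear_diamond_left: "qlinear (\<lambda>p. p \<diamondop> r)"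
  and qlinear_diamond_right: "qlinear (diamond p)"
  by (simp_all add: qlinear_iff diamond_def harm_lin qlinear_add[OF qlinear_phi]
      qlinear_smul[OF qlinear_phi])

lemmas diamond_lin =
  qlinear_add[OF qlinear_diamond_left] qlinear_smul[OF qlinear_diamond_left]
  qlinear_diff[OF qlinear_diamond_left] qlinear_zero[OF qlinear_diamond_left]
  qlinear_add[OF qlinear_diamond_right] qlinear_smul[OF qlinear_diamond_right]
  qlinear_diff[OF qlinear_diamond_right] qlinear_zero[OF qlinear_diamond_right]

lemma diamond_one_left: "1 \<diamondop> w = w"
  and diamond_one_right: "w \<diamondop> 1 = w"
  by (simp_all add: diamond_def phi_one harm_one_left harm_one_right phi_phi)

lemma diamond_Z_left: "(Z * u) \<diamondop> v = Z * (u \<diamondop> v)"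
  and diamond_Z_right: "u \<diamondop> (Z * v) = Z * (u \<diamondop> v)"
  by (simp_all add: diamond_def phi_mult phi_Z phi_X harm_X_left harm_X_right)

text \<open>The recursion of \<open>\<star>\<close> conjugated by \<open>phi\<close>: the sign in
  \<open>phi Y = - Y\<close> cancels in the first two summands and survives in the third, where
  \<open>Y * X\<close> becomes \<open>- (Y * Z)\<close>.\<close>

lemma diamond_Y_Y:
  "(Y * u) \<diamondop> (Y * v) = Y * (u \<diamondop> (Y * v) + (Y * u) \<diamondop> v - Z * (u \<diamondop> v))"
proof -
  have "(Y * u) \<diamondop> (Y * v) = phi ((Y * phi u) \<star> (Y * phi v))"
    by (simp add: diamond_def phi_mult phi_Y qlinear_minus[OF qlinear_harm_left]
        qlinear_minus[OF qlinear_harm_right])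
  moreover have "u \<diamondop> (Y * v) = - phi (phi u \<star> (Y * phi v))"
    "(Y * u) \<diamondop> v = - phi ((Y * phi u) \<star> phi v)"
    by (simp_all add: diamond_def phi_mult phi_Y qlinear_minus[OF qlinear_harm_left]
        qlinear_minus[OF qlinear_harm_right] qlinear_minus[OF qlinear_phi])
  ultimately show ?thesis
    by (simp add: harm_Y_Y qlinear_add[OF qlinear_phi] phi_mult phi_X phi_Y
        diamond_def[of u v] algebra_simps)
qed

lemma diamond_commute: "u \<diamondop> v = v \<diamondop> u"
proof (induction u arbitrary: v rule: ncpoly_YZ_induct)
  case (Y u)
  show ?case
    by (induction v rule: ncpoly_YZ_induct)
      (simp_all add: diamond_lin diamond_one_left diamond_one_right diamond_Z_left
        diamond_Z_right diamond_Y_Y Y.IH add.commute)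
qed (simp_all add: diamond_lin diamond_one_left diamond_one_right diamond_Z_left diamond_Z_right)

lemma Y_diamond_Y: "(Y * w) \<diamondop> Y = Y * (w \<diamondop> Y - X * w)"
  using diamond_Y_Y[of w 1] by (simp add: diamond_one_right Z_def algebra_simps)

lemma diamond_Y_diamond: "(w \<diamondop> Y) \<diamondop> v = (w \<diamondop> v) \<diamondop> Y"
proof (induction w arbitrary: v rule: ncpoly_YZ_induct)
  case one
  then show ?case by (metis diamond_one_left diamond_commute)
next
  case (Y w)
  note IHw = Y.IH
  \<comment> \<open>\<open>X\<close> does not leave a factor of \<open>\<diamondop>\<close>, but
    \<open>Z\<close> does.\<close>
  have X: "X = Z - Y" by (simp add: Z_def)
  show ?case
  proof (induction v rule: ncpoly_YZ_induct)
    case (Y v)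
    let ?F = "w \<diamondop> Y - X * w"
    have "((Y * w) \<diamondop> Y) \<diamondop> (Y * v)
        = Y * (?F \<diamondop> (Y * v) + ((Y * w) \<diamondop> Y) \<diamondop> v - Z * (?F \<diamondop> v))"
      by (simp only: Y_diamond_Y diamond_Y_Y)
    also have "\<dots> = ((Y * w) \<diamondop> (Y * v)) \<diamondop> Y"
      \<comment> \<open>The inner hypothesis comes first, since \<open>Y_diamond_Y\<close> would
        rewrite its left-hand side.\<close>
      unfolding Y.IH
      by (simp add: diamond_Y_Y Y_diamond_Y X diamond_lin diamond_Z_left IHw
          algebra_simps)
    finally show ?case .
  qed (simp_all add: diamond_lin diamond_one_right diamond_Z_left diamond_Z_right)
qed (simp_all add: diamond_lin diamond_one_right diamond_Z_left)

lemma partial_X: "partial n X = Y * Z ^ (n - 1) * X"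
  and partial_Y: "partial n Y = - (Y * Z ^ (n - 1) * X)"
  using is_partial_partial[of n] by (auto simp: is_partial_def)

lemma partial_Z: "partial n Z = 0"
  by (simp add: Z_def qlinear_add[OF qlinear_partial] partial_X partial_Y)

text \<open>Both sides, as functions \<open>f\<close> of \<open>w\<close>, send 1 to
  \<open>Y\<close>, commute with left multiplication by \<open>Z\<close> (as
  \<open>partial 1 Z = 0\<close>) and satisfy \<open>f (Y * w) = Y * (f w - X * w)\<close>.\<close>

lemma diamond_Y: "w \<diamondop> Y = partial 1 w + w * Y"
proof (induction w rule: ncpoly_YZ_induct)
  case (Y w)
  then show ?case
    by (simp add: Y_diamond_Y partial_mult partial_Y algebra_simps)
qed (simp_all add: diamond_lin qlinear_zero[OF qlinear_partial] qlinear_add[OF qlinear_partial]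
    qlinear_smul[OF qlinear_partial] partial_one partial_mult partial_Z diamond_one_left
    diamond_Z_left smul_alg algebra_simps)

section \<open>The derivation property of \<open>theta_tilde\<close>\<close>

lemma degop_mult: "degop (u * v) = degop u * v + u * degop v"
  by (rule qlinear_eqI2[where B = "\<lambda>u v. degop (u * v)" and C = "\<lambda>u v. degop u * v + u * degop v"])
    (simp_all add: qlinear_iff algebra_simps qlinear_add[OF qlinear_degop]
      qlinear_smul[OF qlinear_degop] smul_alg mon_mult degop_mon)

lemma degop_one: "degop 1 = 0"
  and degop_Y: "degop Y = Y"
  and degop_Z: "degop Z = Z"
  by (simp_all add: mon_Nil[symmetric] Z_def X_def Y_def degop_mon qlinear_add[OF qlinear_degop])

lemma qlinear_theta: "qlinear (theta c)"
  and theta_one: "theta c 1 = 0"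
  and theta_X: "theta c X = X * Z"
  and theta_Y: "theta c Y = Y * Z"
  and theta_mult: "theta c (u * v) = theta c u * v + u * theta c v + c *\<^sub>Q (degop u * partial 1 v)"
  using is_theta_theta[of c] by (auto simp: is_theta_def)

lemma theta_Z: "theta c Z = Z * Z"
  by (metis Z_def distrib_right qlinear_add qlinear_theta theta_X theta_Y)

lemma qlinear_theta_tilde: "qlinear (theta_tilde c)"
  by (simp add: qlinear_iff theta_tilde_def qlinear_add[OF qlinear_theta]
      qlinear_smul[OF qlinear_theta] qlinear_add[OF qlinear_degop] qlinear_smul[OF qlinear_degop]
      smul_alg algebra_simps)

lemmas theta_tilde_lin =
  qlinear_add[OF qlinear_theta_tilde] qlinear_smul[OF qlinear_theta_tilde]
  qlinear_diff[OF qlinear_theta_tilde] qlinear_zero[OF qlinear_theta_tilde]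

lemma theta_tilde_one: "theta_tilde c 1 = 0"
  by (simp add: theta_tilde_def theta_one degop_one)

text \<open>Both letters have degree 1, so the \<open>degop\<close> of the leading letter
  contributes \<open>c\<close> times that letter times \<open>partial 1 w + w * Y\<close>, which is
  \<open>w \<diamondop> Y\<close>.\<close>

lemma theta_tilde_Y_mult:
    "theta_tilde c (Y * w) = Y * (Z * w + theta_tilde c w + c *\<^sub>Q (w \<diamondop> Y))"
  and theta_tilde_Z_mult:
    "theta_tilde c (Z * w) = Z * (Z * w + theta_tilde c w + c *\<^sub>Q (w \<diamondop> Y))"
  by (simp_all add: theta_tilde_def theta_mult theta_Y theta_Z degop_mult degop_Y degop_Z
      diamond_Y smul_alg algebra_simps)

lemma theta_tilde_diamond:
  "theta_tilde c (w \<diamondop> v) = theta_tilde c w \<diamondop> v + w \<diamondop> theta_tilde c v"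
proof (induction w arbitrary: v rule: ncpoly_YZ_induct)
  case (Y w)
  note IHw = Y.IH
  show ?case
  proof (induction v rule: ncpoly_YZ_induct)
    case (Y v)
    let ?E = "\<lambda>p. Z * p + theta_tilde c p + c *\<^sub>Q (p \<diamondop> Y)"
    let ?A = "w \<diamondop> (Y * v) + (Y * w) \<diamondop> v - Z * (w \<diamondop> v)"
    \<comment> \<open>Lets the \<open>c\<close>-terms \<open>r \<diamondop> Y\<close> leave the
      right factor as they leave the left one.\<close>
    have comm: "p \<diamondop> (r \<diamondop> Y) = (p \<diamondop> r) \<diamondop> Y" for p r
      by (metis diamond_commute diamond_Y_diamond)
    have "theta_tilde c ((Y * w) \<diamondop> (Y * v)) = Y * ?E ?A"
      by (simp only: diamond_Y_Y theta_tilde_Y_mult)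
    also have "?E ?A = (?E w \<diamondop> (Y * v) + (Y * ?E w) \<diamondop> v - Z * (?E w \<diamondop> v))
        + (w \<diamondop> (Y * ?E v) + (Y * w) \<diamondop> ?E v - Z * (w \<diamondop> ?E v))"
      \<comment> \<open>Folding \<open>Y * ?E p\<close> back into
        \<open>theta_tilde c (Y * p)\<close> gives the shape of both induction hypotheses.\<close>
      unfolding theta_tilde_Y_mult[symmetric]
      by (simp add: theta_tilde_lin diamond_lin IHw Y.IH theta_tilde_Z_mult diamond_Z_left
          diamond_Z_right diamond_Y_diamond comm smul_alg smul_diff algebra_simps)
    also have "Y * \<dots> = theta_tilde c (Y * w) \<diamondop> (Y * v) + (Y * w) \<diamondop> theta_tilde c (Y * v)"
      unfolding theta_tilde_Y_mult diamond_Y_Y by (rule distrib_left)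
    finally show ?case .
  next
    case (Z v)
    have "(Y * w) \<diamondop> (v \<diamondop> Y) = ((Y * w) \<diamondop> v) \<diamondop> Y"
      by (metis diamond_commute diamond_Y_diamond)
    then show ?case
      by (simp add: theta_tilde_lin diamond_lin Z theta_tilde_Z_mult diamond_Z_right algebra_simps)
  qed (simp_all add: theta_tilde_lin diamond_lin diamond_one_right theta_tilde_one smul_alg
      algebra_simps)
qed (simp_all add: theta_tilde_lin diamond_lin diamond_one_left theta_tilde_one
    theta_tilde_Z_mult diamond_Z_left diamond_Y_diamond smul_alg algebra_simps)

section \<open>Iterated commutators with \<open>theta\<close>\<close>

lemma qlinear_ad: "qlinear T \<Longrightarrow> qlinear D \<Longrightarrow> qlinear (ad T D)"
  by (simp add: qlinear_iff ad_def smul_diff)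

lemma qlinear_ad_power: "qlinear T \<Longrightarrow> qlinear D \<Longrightarrow> qlinear ((ad T ^^ k) D)"
  by (induction k) (simp_all add: qlinear_ad)

lemma theta_mult_Z: "theta c (w * Z) = theta c w * Z + w * Z * Z"
  by (simp add: theta_mult partial_Z theta_Z mult.assoc)

text \<open>The extra summand \<open>w * Z * Z\<close> of \<open>theta_mult_Z\<close> contributes
  \<open>D w * Z * Z\<close> to both halves of the commutator and cancels.\<close>

lemma ad_theta_power_mult_Z:
  "(ad (theta c) ^^ k) (partial 1) (w * Z) = (ad (theta c) ^^ k) (partial 1) w * Z"
proof (induction k arbitrary: w)
  case 0
  then show ?case by (simp add: partial_mult partial_Z)
next
  case (Suc k)
  define D where "D = (ad (theta c) ^^ k) (partial 1)"
  have "qlinear D"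
    unfolding D_def by (intro qlinear_ad_power qlinear_theta qlinear_partial)
  then show ?case
    using Suc.IH unfolding funpow.simps comp_apply D_def[symmetric]
    \<comment> \<open>Products stay nested to the left, so that rules for a trailing
      \<open>Z\<close> match.\<close>
    by (simp add: ad_def theta_mult_Z qlinear_add algebra_simps del: mult.assoc)
qed

text \<open>Since \<open>partial 1 X = Y * X\<close>, the twist in \<open>theta_mult\<close> becomes
  exactly the correction term of \<open>theta_tilde\<close>.\<close>

lemma theta_mult_X:
  "theta c (w * X) = theta_tilde c w * X + w * X * Z"
  by (simp add: theta_tilde_def theta_mult theta_X partial_X smul_alg algebra_simps)

text \<open>With \<open>q\<close> the current iterate, the terms
  \<open>(w \<diamondop> q) * X * Z\<close> cancel in the commutator; what remains before
  \<open>X\<close> is \<open>theta_tilde c (w \<diamondop> q) - theta_tilde c w \<diamondop>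
  q\<close>, that is \<open>w \<diamondop> theta_tilde c q\<close>.\<close>

lemma ad_theta_power_mult_X:
  "(ad (theta c) ^^ k) (partial 1) (w * X) = (w \<diamondop> (theta_tilde c ^^ k) Y) * X"
proof (induction k arbitrary: w)
  case 0
  then show ?case by (simp add: partial_mult partial_X diamond_Y algebra_simps)
next
  case (Suc k)
  define D where "D = (ad (theta c) ^^ k) (partial 1)"
  have "qlinear D"
    unfolding D_def by (intro qlinear_ad_power qlinear_theta qlinear_partial)
  then show ?case
    using Suc.IH unfolding funpow.simps comp_apply D_def[symmetric]
    by (simp add: ad_def theta_mult_X qlinear_add ad_theta_power_mult_Z[of k c, folded D_def]
        theta_tilde_diamond algebra_simps del: mult.assoc)
qed

theorem theorem2p2:
  fixes n :: nat and c :: rat and w :: ncpoly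
  assumes "n \<ge> 1"
  shows "partial_c n c (w * X) = (w \<diamondop> q_poly n c) * X"
  by (simp only: partial_c_def q_poly_def ad_theta_power_mult_X diamond_lin smul_mult_left)

end
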